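(* For every instance $(E,Q,\hat c,\delta,\Gamma)$ of a multi-objective cardinality-constrained uncertain combinatorial optimization problem, the improved general algorithm DSA (with reduced index sets and with solution checking, as described in the context) finds a complete set of robust efficient solutions, and during its execution at most $$\prod_{i=1}^k\left(\left\lceil\frac{|E|-\Gamma_i}{2}\right\rceil+1\right)$$ deterministic subproblems $\mathcal{GMP}(l)$ have to be solved.
   Context: Vectors: for $y^1,y^2\in\mathbb R^k$, $y^1$ dominates $y^2$ if $y^1_i\le y^2_i$ for all $i$ and $y^1\ne y^2$. For a multi-objective problem $\min_{x\in X}f(x)$ with $f:X\to\mathbb R^k$, $x'$ dominates $x$ if $f(x')$ dominates $f(x)$; $x\in X$ is efficient if no $x'\in X$ dominates it; two efficient solutions $x,x'$ are equivalent if $f(x)=f(x')$; a set $\bar X\subseteq X$ of efficient solutions is complete if every $x\in X\setminus\bar X$ is dominated by or equivalent to some $x'\in\bar X$. Instance: $E$ is a finite set, $Q\subseteq 2^E$ the set of feasible solutions, $k\ge2$ the number of objectives; for $e\in E$, $i\in\{1,\dots,k\}$ there are a nominal cost $\hat c_{e,i}\in\mathbb R$ and an interval length $\delta_{e,i}\ge0$; $\Gamma=(\Gamma_1,\dots,\Gamma_k)$ with integers $0\le\Gamma_i\le|E|$. The uncertainty set is $$\mathcal U=\{c\in\mathbb R^{|E|\times k}: c_{e,i}\in[\hat c_{e,i},\hat c_{e,i}+\delta_{e,i}]\ \forall e,i;\ |\{e: c_{e,i}>\hat c_{e,i}\}|\le\Gamma_i\ \forall i\}.$$ For $q\in Q$,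 $z^R(q)=(z^R_1(q),\dots,z^R_k(q))$ with $z^R_i(q)=\max_{c\in\mathcal U}\sum_{e\in q}c_{e,i}$. Robust efficient means efficient for $\min_{q\in Q}z^R(q)$; a complete set of robust efficient solutions is a complete set of efficient solutions for this problem. For each objective $i$, sort $E$ in descending order of $\delta_{e,i}$ and let $E^i_j$ be the set of the first $j$ elements in this order ($j=1,\dots,|E|$), $E^i_{|E|+1}:=E$; put $\bar\delta^i_j:=\min_{e\in E^i_j}\delta_{e,i}$ for $j\le|E|$ and $\bar\delta^i_{|E|+1}:=0$. For $l\in\{1,\dots,|E|+1\}^k$, $\mathcal{GMP}(l)$ is $\min_{q\in Q}g^l(q)$ with components $g^l_i(q):=\sum_{e\in q}\hat c_{e,i}+\Gamma_i\bar\delta^i_{l_i}+\sum_{e\in q\cap E^i_{l_i}}(\delta_{e,i}-\bar\delta^i_{l_i})$. Improved general DSA: (1) Reduced index sets: for each $i$ determine $L_i$ as follows. Start with $m:=\Gamma_i+1$, $L_i:=\{m\}$. While $m<|E|+1$ repeat: while $m<|E|+1$ and $\bar\delta^i_m=\bar\delta^i_{m+1}$, set $m:=m+1$; then, if $m<|E|+1$, set $m:=m+1$, after that, if still $m<|E|+1$, set $m:=m+1$ once more, and then add $m$ to $L_i$. Put $L:=L_1\times\dots\times L_k$. (2) Solving with solution checking: initialize $\tilde l^1:=(0,\dots,0)$, $h:=1$. Run $k$ nested for-loops, the $j$-th one (loop 1 outermost) running over $l_j\in L_j$ in increasing order. In the body of the innermost loop, with $l:=(l_1,\dots,l_k)$: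 (a) if $\tilde l^h=(0,\dots,0)$ or some set in $OPT^{\tilde l^h}$ contains an element of $E^h_{l_h}$, solve $\mathcal{GMP}(l)$, i.e. compute some complete set of efficient solutions $OPT^l$ of it; otherwise set $OPT^l:=OPT^{\tilde l^h}$ without solving a subproblem; (b) for $i=h,\dots,k$ set $\tilde l^i:=l$; (c) set $h:=k$. For $j<k$, at the end of each iteration of loop $j$ (after the loop $j+1$ nested in it has finished) set $h:=j$. (3) Output all $q\in A:=\bigcup_{l\in L}OPT^l$ for which no $q'\in A$ has $z^R(q')$ dominating $z^R(q)$. *)

theory Defs
  imports Complex_Main "HOL-Library.FuncSet" "HOL-Library.While_Combinator"
begin

text \<open>
  Objectives are indexed by \<open>1, \<dots>, k\<close>. A vector of \<open>k\<close> reals is a function on \<open>nat\<close> of which only the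
  values on \<open>{1..k}\<close> matter, so equality of such vectors is always restricted to \<open>{1..k}\<close>.
\<close>

definition dominates :: "nat \<Rightarrow> (nat \<Rightarrow> real) \<Rightarrow> (nat \<Rightarrow> real) \<Rightarrow> bool" where
  "dominates k y1 y2 \<longleftrightarrow> (\<forall>i\<in>{1..k}. y1 i \<le> y2 i) \<and> (\<exists>i\<in>{1..k}. y1 i \<noteq> y2 i)"

definition efficient :: "nat \<Rightarrow> 'x set \<Rightarrow> ('x \<Rightarrow> nat \<Rightarrow> real) \<Rightarrow> 'x \<Rightarrow> bool" where
  "efficient k X f x \<longleftrightarrow> x \<in> X \<and> \<not> (\<exists>x'\<in>X. dominates k (f x') (f x))"

definition equivalent :: "nat \<Rightarrow> 'x set \<Rightarrow> ('x \<Rightarrow> nat \<Rightarrow> real) \<Rightarrow> 'x \<Rightarrow> 'x \<Rightarrow> bool" where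
  "equivalent k X f x x' \<longleftrightarrow>
     efficient k X f x \<and> efficient k X f x' \<and> (\<forall>i\<in>{1..k}. f x i = f x' i)"

definition complete_efficient_set ::
    "nat \<Rightarrow> 'x set \<Rightarrow> ('x \<Rightarrow> nat \<Rightarrow> real) \<Rightarrow> 'x set \<Rightarrow> bool" where
  "complete_efficient_set k X f S \<longleftrightarrow>
     (\<forall>x\<in>S. efficient k X f x) \<and>
     (\<forall>x\<in>X - S. \<exists>x'\<in>S. dominates k (f x') (f x) \<or> equivalent k X f x x')"

record 'e robust_instance =
  ground :: "'e set"
  feasible :: "'e set set"
  nobj :: nat
  nominal :: "'e \<Rightarrow> nat \<Rightarrow> real"
  deviation :: "'e \<Rightarrow> nat \<Rightarrow> real"
  budget :: "nat \<Rightarrow> nat"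

definition valid_instance :: "'e robust_instance \<Rightarrow> bool" where
  "valid_instance I \<longleftrightarrow>
     finite (ground I) \<and> feasible I \<subseteq> Pow (ground I) \<and> nobj I \<ge> 2 \<and>
     (\<forall>e\<in>ground I. \<forall>i\<in>{1..nobj I}. deviation I e i \<ge> 0) \<and>
     (\<forall>i\<in>{1..nobj I}. budget I i \<le> card (ground I))"

text \<open>Entries \<open>c e i\<close> outside \<open>ground I \<times> {1..nobj I}\<close> are left free; no objective reads them.\<close>

definition uncertainty_set :: "'e robust_instance \<Rightarrow> ('e \<Rightarrow> nat \<Rightarrow> real) set" where
  "uncertainty_set I =
     {c. (\<forall>e\<in>ground I. \<forall>i\<in>{1..nobj I}.
            c e i \<in> {nominal I e i .. nominal I e i + deviation I e i}) \<and>
         (\<forall>i\<in>{1..nobj I}. card {e \<in> ground I. c e i > nominal I e i} \<le> budget I i)}"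

text \<open>The maximum over the (infinite) uncertainty set is the greatest attained value.\<close>

definition robust_cost :: "'e robust_instance \<Rightarrow> 'e set \<Rightarrow> nat \<Rightarrow> real" where
  "robust_cost I q i = (GREATEST v. v \<in> (\<lambda>c. \<Sum>e\<in>q. c e i) ` uncertainty_set I)"

text \<open>
  \<open>ord i\<close> lists the ground set in descending order of the \<open>i\<close>-th deviations; ties may be broken in
  any way.
\<close>

definition descending_orders :: "'e robust_instance \<Rightarrow> (nat \<Rightarrow> 'e list) \<Rightarrow> bool" where
  "descending_orders I ord \<longleftrightarrow>
     (\<forall>i\<in>{1..nobj I}. distinct (ord i) \<and> set (ord i) = ground I \<and>
        sorted_wrt (\<lambda>a b. deviation I a i \<ge> deviation I b i) (ord i))"

text \<open>For \<open>j > length (ord i)\<close> this is the whole ground set.\<close>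

definition first_elems :: "(nat \<Rightarrow> 'e list) \<Rightarrow> nat \<Rightarrow> nat \<Rightarrow> 'e set" where
  "first_elems ord i j = set (take j (ord i))"

definition min_dev :: "'e robust_instance \<Rightarrow> (nat \<Rightarrow> 'e list) \<Rightarrow> nat \<Rightarrow> nat \<Rightarrow> real" where
  "min_dev I ord i j =
     (if j \<le> card (ground I) then Min ((\<lambda>e. deviation I e i) ` first_elems ord i j) else 0)"

definition gmp_cost ::
    "'e robust_instance \<Rightarrow> (nat \<Rightarrow> 'e list) \<Rightarrow> (nat \<Rightarrow> nat) \<Rightarrow> 'e set \<Rightarrow> nat \<Rightarrow> real" where
  "gmp_cost I ord l q i =
     (\<Sum>e\<in>q. nominal I e i) + real (budget I i) * min_dev I ord i (l i)
     + (\<Sum>e\<in>q \<inter> first_elems ord i (l i). deviation I e i - min_dev I ord i (l i))"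

text \<open>
  A solver returns some complete set for every subproblem. The algorithm solves the subproblem of
  any given index vector at most once, so fixing the answers beforehand by a function of the index
  vector loses no possible run. Index vectors are extensional functions on \<open>{1..nobj I}\<close>.
\<close>

definition gmp_solver ::
    "'e robust_instance \<Rightarrow> (nat \<Rightarrow> 'e list) \<Rightarrow> ((nat \<Rightarrow> nat) \<Rightarrow> 'e set set) \<Rightarrow> bool" where
  "gmp_solver I ord solve \<longleftrightarrow>
     (\<forall>l \<in> {1..nobj I} \<rightarrow>\<^sub>E {1..card (ground I) + 1}.
        complete_efficient_set (nobj I) (feasible I) (gmp_cost I ord l) (solve l))"

definition reduced_indices :: "'e robust_instance \<Rightarrow> (nat \<Rightarrow> 'e list) \<Rightarrow> nat \<Rightarrow> nat set" where
  "reduced_indices I ord i =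
     (let N = card (ground I) + 1 in
      snd (while (\<lambda>(m, L). m < N)
        (\<lambda>(m, L).
           let m1 = while (\<lambda>m. m < N \<and> min_dev I ord i m = min_dev I ord i (m + 1)) (\<lambda>m. m + 1) m;
               m2 = (if m1 < N then m1 + 1 else m1);
               m3 = (if m2 < N then m2 + 1 else m2)
           in (m3, insert m3 L))
        (budget I i + 1, {budget I i + 1})))"

text \<open>
  In the state of the second phase, \<open>opt l\<close> is the solution set stored for the index vector \<open>l\<close>,
  \<open>ref i\<close> is the index vector written \<open>l\<close> with a tilde and superscript \<open>i\<close>, \<open>level\<close> is the variable \<open>h\<close>, and \<open>num_solved\<close> counts
  the subproblems solved so far.
\<close>

record 'e dsa_state =
  opt :: "(nat \<Rightarrow> nat) \<Rightarrow> 'e set set"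
  ref :: "nat \<Rightarrow> nat \<Rightarrow> nat"
  level :: nat
  num_solved :: nat

definition zero_index :: "nat \<Rightarrow> nat \<Rightarrow> nat" where
  "zero_index k = (\<lambda>i\<in>{1..k}. 0)"

text \<open>Variables that the algorithm does not initialise start with the unspecified value.\<close>

definition dsa_init :: "nat \<Rightarrow> 'e dsa_state" where
  "dsa_init k =
     \<lparr>opt = (\<lambda>_. undefined), ref = (\<lambda>_. undefined)(1 := zero_index k), level = 1, num_solved = 0\<rparr>"

definition dsa_body ::
    "'e robust_instance \<Rightarrow> (nat \<Rightarrow> 'e list) \<Rightarrow> ((nat \<Rightarrow> nat) \<Rightarrow> 'e set set) \<Rightarrow>
     (nat \<Rightarrow> nat) \<Rightarrow> 'e dsa_state \<Rightarrow> 'e dsa_state" where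
  "dsa_body I ord solve l s =
     (let h = level s;
          s1 = (if ref s h = zero_index (nobj I) \<or>
                   (\<exists>q\<in>opt s (ref s h). q \<inter> first_elems ord h (l h) \<noteq> {})
                then s\<lparr>opt := (opt s)(l := solve l), num_solved := num_solved s + 1\<rparr>
                else s\<lparr>opt := (opt s)(l := opt s (ref s h))\<rparr>)
      in s1\<lparr>ref := (\<lambda>i. if i \<in> {h..nobj I} then l else ref s i), level := nobj I\<rparr>)"

text \<open>
  \<open>dsa_loops I ord solve [j, j + 1, \<dots>, nobj I] l s\<close> runs loop \<open>j\<close> together with the loops nested in it,
  where \<open>l\<close> carries the current values of the loop variables \<open>1, \<dots>, j - 1\<close>.
\<close>

primrec dsa_loops ::
    "'e robust_instance \<Rightarrow> (nat \<Rightarrow> 'e list) \<Rightarrow> ((nat \<Rightarrow> nat) \<Rightarrow> 'e set set) \<Rightarrow>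
     nat list \<Rightarrow> (nat \<Rightarrow> nat) \<Rightarrow> 'e dsa_state \<Rightarrow> 'e dsa_state" where
  "dsa_loops I ord solve [] l s = dsa_body I ord solve l s"
| "dsa_loops I ord solve (j # js) l s =
     fold (\<lambda>m s. let s' = dsa_loops I ord solve js (l(j := m)) s
                 in if j < nobj I then s'\<lparr>level := j\<rparr> else s')
       (sorted_list_of_set (reduced_indices I ord j)) s"

definition dsa_run ::
    "'e robust_instance \<Rightarrow> (nat \<Rightarrow> 'e list) \<Rightarrow> ((nat \<Rightarrow> nat) \<Rightarrow> 'e set set) \<Rightarrow> 'e dsa_state" where
  "dsa_run I ord solve =
     dsa_loops I ord solve [1..<nobj I + 1] (\<lambda>_. undefined) (dsa_init (nobj I))"

definition dsa_output ::
    "'e robust_instance \<Rightarrow> (nat \<Rightarrow> 'e list) \<Rightarrow> ((nat \<Rightarrow> nat) \<Rightarrow> 'e set set) \<Rightarrow> 'e set set" where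
  "dsa_output I ord solve =
     (let A = (\<Union>l \<in> (\<Pi>\<^sub>E i\<in>{1..nobj I}. reduced_indices I ord i). opt (dsa_run I ord solve) l)
      in {q \<in> A. \<not> (\<exists>q'\<in>A. dominates (nobj I) (robust_cost I q') (robust_cost I q))})"

end

theory Submission
  imports Defs
begin

text \<open>
  Everything rests on one weak notion: a set of feasible solutions covers a problem if every
  feasible solution is componentwise at least as expensive as some member of the set. Complete sets
  cover, and conversely the nondominated members of any covering set form a complete set
  (\<open>nondominated_of_cover_complete\<close>). Covers may contain inefficient solutions, which makes them
  robust enough to survive the shortcuts of the algorithm; the final filter restores efficiency.

  The robust cost of \<open>q\<close> in objective \<open>i\<close> is the nominal cost plus the \<open>\<Gamma>\<^sub>i\<close> largest deviations in \<open>q\<close>.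
  The cost in \<open>GMP(l)\<close> depends on \<open>l\<^sub>i\<close> only through the threshold \<open>\<theta>\<close>, the deviation at that index: it
  is the nominal cost plus \<open>\<Gamma>\<^sub>i \<theta> + (\<Sum>e\<in>q. max (\<delta>\<^sub>e - \<theta>) 0)\<close>. It never lies below the robust cost, and
  it equals the robust cost when \<open>\<theta>\<close> separates the \<open>\<Gamma>\<^sub>i\<close> largest deviations in \<open>q\<close> from the remaining
  ones. If exactly \<open>\<Gamma>\<^sub>i\<close> elements of \<open>q\<close> are among the first \<open>p \<ge> 1\<close> elements of the order, the deviations
  at \<open>p\<close> and at \<open>p + 1\<close> both separate. Hence of two consecutive indices one suffices, and of several indices
  with equal deviations one suffices: this is why the reduced index sets lose nothing
  (\<open>robust_cost_attained\<close>). As the objectives choose their thresholds independently, the union of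
  covers of all \<open>GMP(l)\<close> with \<open>l\<close> in the reduced product covers the robust problem
  (\<open>union_of_gmp_covers\<close>). A step in the construction of an index set advances by at least two
  positions unless it reaches the end, which gives the bound on the size of the index sets.

  Reusing an earlier answer is safe (\<open>cover_transfer\<close>): the reference vector differs from the current
  one in a single component \<open>h\<close> and has a smaller index there, so a larger threshold. If no stored
  solution meets the first \<open>l\<^sub>h\<close> elements, raising the index lowers the costs of all stored solutions
  by the change of the constant term \<open>\<Gamma>\<^sub>h \<theta>\<close>, and the cost of every other solution by at most
  that, so the stored set stays a cover. What remains is to see that the nested loops keep such
  references (\<open>dsa_loops_runs_block\<close>).
\<close>

section \<open>Covering sets\<close>

definition covers :: "nat \<Rightarrow> 'x set \<Rightarrow> ('x \<Rightarrow> nat \<Rightarrow> real) \<Rightarrow> 'x set \<Rightarrow> bool" where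
  "covers k X f S \<longleftrightarrow> S \<subseteq> X \<and> (\<forall>x\<in>X. \<exists>y\<in>S. \<forall>i\<in>{1..k}. f y i \<le> f x i)"

lemma complete_efficient_set_covers:
  assumes "complete_efficient_set k X f S"
  shows "covers k X f S"
  unfolding covers_def
proof (intro conjI ballI)
  show "S \<subseteq> X"
    using assms by (auto simp: complete_efficient_set_def efficient_def)
next
  fix x assume "x \<in> X"
  show "\<exists>y\<in>S. \<forall>i\<in>{1..k}. f y i \<le> f x i"
  proof (cases "x \<in> S")
    case False
    then obtain y where "y \<in> S" "dominates k (f y) (f x) \<or> equivalent k X f x y"
      using assms \<open>x \<in> X\<close> unfolding complete_efficient_set_def by blast
    then show ?thesis
      by (intro bexI[of _ y]) (auto simp: dominates_def equivalent_def)
  qed auto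
qed

text \<open>
  Among the members of \<open>A\<close> that are nowhere worse than \<open>a\<close>, one with the least sum of objectives is
  nondominated, since anything dominating it would again be such a member with a smaller sum.
\<close>
lemma finite_nondominated_below:
  assumes "finite A" "a \<in> A"
  shows "\<exists>b\<in>A. (\<forall>i\<in>{1..k}. f b i \<le> f a i) \<and> \<not> (\<exists>c\<in>A. dominates k (f c) (f b))"
proof -
  let ?B = "{b\<in>A. \<forall>i\<in>{1..k}. f b i \<le> f a i}"
  let ?g = "\<lambda>b. \<Sum>i=1..k. f b i"
  have "finite ?B" "?B \<noteq> {}"
    using assms by auto
  then obtain b where b: "is_arg_min ?g (\<lambda>b. b \<in> ?B) b"
    using ex_is_arg_min_if_finite[of ?B ?g] by blast
  have bB: "b \<in> ?B"
    using b unfolding is_arg_min_def by (rule conjunct1)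
  have min: "\<not> ?g c < ?g b" if "c \<in> ?B" for c
    using b that unfolding is_arg_min_def by blast
  have "\<not> dominates k (f c) (f b)" if "c \<in> A" for c
  proof
    assume dom: "dominates k (f c) (f b)"
    then have le: "\<forall>i\<in>{1..k}. f c i \<le> f b i" and "\<exists>i\<in>{1..k}. f c i < f b i"
      by (auto simp: dominates_def less_le)
    then have "?g c < ?g b"
      by (intro sum_strict_mono_ex1) auto
    moreover have "c \<in> ?B"
      using le bB \<open>c \<in> A\<close> by (blast intro: order.trans)
    ultimately show False
      using min by blast
  qed
  then show ?thesis
    using bB by blast
qed

text \<open>
  Nondominated within a cover means efficient: a feasible solution dominating a member would have a
  member of the cover below it, which would then dominate as well.
\<close>
lemma nondominated_of_cover_complete:
  assumes "finite X" "covers k X f A"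
  shows "complete_efficient_set k X f {q \<in> A. \<not> (\<exists>q'\<in>A. dominates k (f q') (f q))}"
    (is "complete_efficient_set k X f ?S")
  unfolding complete_efficient_set_def
proof (intro conjI ballI)
  have "A \<subseteq> X" and below: "\<And>x. x \<in> X \<Longrightarrow> \<exists>y\<in>A. \<forall>i\<in>{1..k}. f y i \<le> f x i"
    using assms(2) by (auto simp: covers_def)
  have eff: "efficient k X f y" if "y \<in> ?S" for y
  proof -
    have "\<not> dominates k (f x) (f y)" if "x \<in> X" for x
    proof
      assume "dominates k (f x) (f y)"
      moreover obtain z where "z \<in> A" "\<forall>i\<in>{1..k}. f z i \<le> f x i"
        using below \<open>x \<in> X\<close> by blast
      ultimately have "dominates k (f z) (f y)"
        unfolding dominates_def by (metis order.antisym order.trans)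
      then show False
        using \<open>y \<in> ?S\<close> \<open>z \<in> A\<close> by blast
    qed
    then show ?thesis
      using \<open>y \<in> ?S\<close> \<open>A \<subseteq> X\<close> by (auto simp: efficient_def)
  qed
  then show "efficient k X f x" if "x \<in> ?S" for x
    using that .
  fix x assume x: "x \<in> X - ?S"
  then obtain a where a: "a \<in> A" "\<forall>i\<in>{1..k}. f a i \<le> f x i"
    using below by blast
  have "finite A"
    using assms(1) \<open>A \<subseteq> X\<close> by (rule rev_finite_subset)
  then obtain b where b: "b \<in> ?S" "\<forall>i\<in>{1..k}. f b i \<le> f a i"
    using finite_nondominated_below[of A a k f] a(1) by blast
  have le: "\<forall>i\<in>{1..k}. f b i \<le> f x i"
    using a(2) b(2) by (meson order.trans)
  have "equivalent k X f x b" if "\<not> dominates k (f b) (f x)"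
  proof -
    have eq: "\<forall>i\<in>{1..k}. f x i = f b i"
      using le that by (force simp: dominates_def)
    then have "dominates k y (f x) \<longleftrightarrow> dominates k y (f b)" for y
      by (simp add: dominates_def)
    then show ?thesis
      using eff[OF b(1)] x eq by (auto simp: equivalent_def efficient_def)
  qed
  then show "\<exists>x'\<in>?S. dominates k (f x') (f x) \<or> equivalent k X f x x'"
    using b(1) by blast
qed

section \<open>The reduced index sets\<close>

locale dsa_instance =
  fixes I :: "'e robust_instance"
    and ord :: "nat \<Rightarrow> 'e list"
    and solve :: "(nat \<Rightarrow> nat) \<Rightarrow> 'e set set"
  assumes valid: "valid_instance I"
    and orders: "descending_orders I ord"
    and solver: "gmp_solver I ord solve"
begin

abbreviation "k \<equiv> nobj I"
abbreviation "n \<equiv> card (ground I)"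
abbreviation "R \<equiv> reduced_indices I ord"
abbreviation "\<theta> \<equiv> min_dev I ord"

lemma budget_le: "i \<in> {1..k} \<Longrightarrow> budget I i \<le> n"
  using valid by (auto simp: valid_instance_def)

text \<open>
  An index \<open>t\<close> stands for a solution with exactly \<open>\<Gamma>\<^sub>i\<close> elements before position \<open>t\<close>; the deviation
  at \<open>t\<close> or at \<open>t - 1\<close> can serve as its threshold. The predecessor is only admitted when it also
  belongs to the range \<open>{\<Gamma>\<^sub>i + 1..n + 1}\<close> from which the reduced indices are taken.
\<close>
definition index_reachable :: "nat \<Rightarrow> nat set \<Rightarrow> nat \<Rightarrow> bool" where
  "index_reachable i L t \<longleftrightarrow>
     (\<exists>l\<in>L. \<theta> i l = \<theta> i t \<or> (budget I i + 1 < t \<and> \<theta> i l = \<theta> i (t - 1)))"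

text \<open>
  The last conjunct says that every index after the first one has cost an advance of two positions;
  only the step that reaches \<open>n + 1\<close> may have been shorter, by one position.
\<close>
definition reduction_invariant :: "nat \<Rightarrow> nat \<times> nat set \<Rightarrow> bool" where
  "reduction_invariant i = (\<lambda>(m, L).
     budget I i + 1 \<le> m \<and> m \<le> n + 1 \<and> m \<in> L \<and> L \<subseteq> {budget I i + 1..m} \<and>
     (\<forall>t\<in>{budget I i + 1..m}. index_reachable i L t) \<and>
     2 * card L + budget I i \<le> m + 1 + (if m = n + 1 then 1 else 0))"

lemma reduction_invariant_bound: "reduction_invariant i (m, L) \<Longrightarrow> m \<le> n + 1"
  by (simp add: reduction_invariant_def)

lemma skip_equal_deviations:
  fixes i m :: nat
  defines "m1 \<equiv> while (\<lambda>m. m < n + 1 \<and> \<theta> i m = \<theta> i (m + 1)) (\<lambda>m. m + 1) m"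
  assumes "m \<le> n + 1"
  shows "m \<le> m1 \<and> m1 \<le> n + 1 \<and> (\<forall>t\<in>{m..m1}. \<theta> i t = \<theta> i m)"
  unfolding m1_def
proof (rule while_rule[where P = "\<lambda>m'. m \<le> m' \<and> m' \<le> n + 1 \<and> (\<forall>t\<in>{m..m'}. \<theta> i t = \<theta> i m)"
      and Q = "\<lambda>m'. m \<le> m' \<and> m' \<le> n + 1 \<and> (\<forall>t\<in>{m..m'}. \<theta> i t = \<theta> i m)"
      and r = "measure (\<lambda>m. n + 1 - m)"])
  fix m'
  assume inv: "m \<le> m' \<and> m' \<le> n + 1 \<and> (\<forall>t\<in>{m..m'}. \<theta> i t = \<theta> i m)"
    and test: "m' < n + 1 \<and> \<theta> i m' = \<theta> i (m' + 1)"
  have "m' \<in> {m..m'}"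
    using inv by simp
  then have "\<theta> i (m' + 1) = \<theta> i m"
    using inv test by metis
  moreover have "{m..m' + 1} = insert (m' + 1) {m..m'}"
    using inv by auto
  ultimately have "\<forall>t\<in>{m..m' + 1}. \<theta> i t = \<theta> i m"
    using inv by (metis insert_iff)
  then show "m \<le> m' + 1 \<and> m' + 1 \<le> n + 1 \<and> (\<forall>t\<in>{m..m' + 1}. \<theta> i t = \<theta> i m)"
    using inv test by (intro conjI) linarith+
  show "(m' + 1, m') \<in> measure (\<lambda>m. n + 1 - m)"
    using test by (simp add: Suc_diff_le less_Suc_eq_le)
next
  show "m \<le> m \<and> m \<le> n + 1 \<and> (\<forall>t\<in>{m..m}. \<theta> i t = \<theta> i m)"
    using assms(2) by simp
qed (assumption, rule wf_measure)

text \<open>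
  The indices up to \<open>m1\<close> share the deviation of \<open>m\<close>, the index \<open>m1 + 1\<close> is served by its predecessor
  \<open>m1\<close>, and \<open>m1 + 2\<close> is added. Capping at \<open>n + 1\<close> only shortens this range.
\<close>
lemma reduction_invariant_step:
  assumes inv: "reduction_invariant i (m, L)" and "m < n + 1"
    and m1: "m \<le> m1" "m1 \<le> n + 1" "\<forall>t\<in>{m..m1}. \<theta> i t = \<theta> i m"
    and m3: "m3 = min (m1 + 2) (n + 1)"
  shows "reduction_invariant i (m3, insert m3 L)"
proof -
  note inv' = inv[unfolded reduction_invariant_def, simplified]
  have "m \<in> L" using inv' by simp
  have "finite L"
    using inv' by (auto intro: finite_subset)
  then have "card (insert m3 L) \<le> card L + 1"
    by (simp add: card_insert_if)
  moreover have "2 * card L + budget I i \<le> m + 1"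
    using inv' \<open>m < n + 1\<close> by auto
  ultimately have "2 * card (insert m3 L) + budget I i \<le> m3 + 1 + (if m3 = n + 1 then 1 else 0)"
    using m1(1,2) m3 \<open>m < n + 1\<close> by auto
  moreover have "index_reachable i (insert m3 L) t" if "t \<in> {budget I i + 1..m3}" for t
  proof -
    have "t \<le> m \<or> (m < t \<and> t \<le> m1) \<or> t = m1 + 1 \<or> t = m3"
      using that m3 by (auto simp: min_def split: if_splits)
    then consider "t \<le> m" | "m < t" "t \<le> m1" | "t = m1 + 1" | "t = m3"
      by blast
    then show ?thesis
    proof cases
      case 1
      then have "index_reachable i L t" using inv' that by simp
      then obtain l where "l \<in> L"
        "\<theta> i l = \<theta> i t \<or> budget I i + 1 < t \<and> \<theta> i l = \<theta> i (t - 1)"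
        unfolding index_reachable_def by blast
      then show ?thesis unfolding index_reachable_def by blast
    next
      case 2
      then have "\<theta> i m = \<theta> i t" using bspec[OF m1(3), of t] by simp
      then show ?thesis using \<open>m \<in> L\<close> unfolding index_reachable_def by blast
    next
      case 3
      \<comment> \<open>This is the skipped index; it exceeds \<open>\<Gamma>\<^sub>i + 1\<close> because \<open>m\<close> already reaches that bound.\<close>
      have "\<theta> i m = \<theta> i (t - 1)" using bspec[OF m1(3), of "t - 1"] m1(1) 3 by simp
      moreover have "budget I i + 1 < t" using inv' m1(1) 3 by simp
      ultimately show ?thesis using \<open>m \<in> L\<close> unfolding index_reachable_def by blast
    next
      case 4
      then show ?thesis unfolding index_reachable_def by blast
    qed
  qed
  moreover have "L \<subseteq> {budget I i + 1..m3}" "budget I i + 1 \<le> m3"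
    using inv' m1(1,2) m3 \<open>m < n + 1\<close> by force+
  ultimately show ?thesis
    using inv' m3 by (auto simp: reduction_invariant_def)
qed

lemma reduction_invariant_final:
  assumes "i \<in> {1..k}"
  shows "reduction_invariant i (n + 1, R i)"
proof -
  define step where "step = (\<lambda>(m, L).
           let m1 = while (\<lambda>m. m < n + 1 \<and> \<theta> i m = \<theta> i (m + 1)) (\<lambda>m. m + 1) m;
               m2 = (if m1 < n + 1 then m1 + 1 else m1);
               m3 = (if m2 < n + 1 then m2 + 1 else m2)
           in (m3, insert m3 L))"
  define final where "final =
    while (\<lambda>(m, L). m < n + 1) step (budget I i + 1, {budget I i + 1})"
  have step: "reduction_invariant i (step (m, L)) \<and> m < fst (step (m, L)) \<and> fst (step (m, L)) \<le> n + 1"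
    if "reduction_invariant i (m, L)" "m < n + 1" for m L
  proof -
    define m1 where "m1 = while (\<lambda>m. m < n + 1 \<and> \<theta> i m = \<theta> i (m + 1)) (\<lambda>m. m + 1) m"
    define m3 where "m3 = min (m1 + 2) (n + 1)"
    have m1: "m \<le> m1" "m1 \<le> n + 1" "\<forall>t\<in>{m..m1}. \<theta> i t = \<theta> i m"
      using skip_equal_deviations[of m i] that(2) unfolding m1_def by (blast intro: less_imp_le)+
    have "step (m, L) = (m3, insert m3 L)"
      using m1(2) unfolding step_def m3_def Let_def split m1_def[symmetric] by (auto simp: min_def)
    moreover have "m < m3" "m3 \<le> n + 1"
      using m1(1,2) that(2) by (auto simp: m3_def)
    ultimately show ?thesis
      using reduction_invariant_step[OF that m1 m3_def] by (simp only: fst_conv)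
  qed
  have end_state: "reduction_invariant i final \<and> \<not> fst final < n + 1"
    unfolding final_def
  proof (rule while_rule[where P = "reduction_invariant i"
        and Q = "\<lambda>s. reduction_invariant i s \<and> \<not> fst s < n + 1" and r = "measure (\<lambda>(m, L). n + 1 - m)"])
    show "reduction_invariant i (budget I i + 1, {budget I i + 1})"
      using budget_le[OF assms] by (auto simp: reduction_invariant_def index_reachable_def)
    show "wf (measure (\<lambda>(m, L :: nat set). n + 1 - m))"
      by simp
  next
    fix s assume *: "reduction_invariant i s" "case s of (m, L) \<Rightarrow> m < n + 1"
    obtain m L where s: "s = (m, L)" by (cases s)
    obtain m' L' where s': "step s = (m', L')" by (cases "step s")
    have inv: "reduction_invariant i (m, L)" "m < n + 1"
      using * unfolding s by simp_all
    show "reduction_invariant i (step s)"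
      using step[OF inv] unfolding s by blast
    show "(step s, s) \<in> measure (\<lambda>(m, L). n + 1 - m)"
      using step[OF inv] inv(2) s' unfolding s by simp arith
  qed auto
  obtain m L where final: "final = (m, L)"
    by (cases final)
  have "m \<le> n + 1"
    using end_state unfolding final by (auto dest: reduction_invariant_bound)
  then have "m = n + 1"
    using end_state unfolding final by simp
  moreover have "R i = snd final"
    unfolding reduced_indices_def final_def step_def Let_def ..
  ultimately show ?thesis
    using end_state unfolding final by simp
qed

lemma reduced_indices_subset:
  assumes "i \<in> {1..k}"
  shows "R i \<subseteq> {1..n + 1}"
proof -
  have "R i \<subseteq> {budget I i + 1..n + 1}"
    using reduction_invariant_final[OF assms] unfolding reduction_invariant_def by simp
  also have "\<dots> \<subseteq> {1..n + 1}"
    by auto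
  finally show ?thesis .
qed

lemma finite_reduced_indices: "i \<in> {1..k} \<Longrightarrow> finite (R i)"
  using finite_subset[OF reduced_indices_subset] by simp

lemma last_index_reduced: "i \<in> {1..k} \<Longrightarrow> n + 1 \<in> R i"
  using reduction_invariant_final[of i] unfolding reduction_invariant_def by simp

lemma index_reachable_reduced:
  "\<lbrakk>i \<in> {1..k}; t \<in> {budget I i + 1..n + 1}\<rbrakk> \<Longrightarrow> index_reachable i (R i) t"
  using reduction_invariant_final[of i] unfolding reduction_invariant_def by simp

text \<open>
  At \<open>m = n + 1\<close> the invariant reads \<open>2 (card (R i) - 1) \<le> (n - \<Gamma>\<^sub>i) + 1\<close>, which for integers is the
  rounded-up half.
\<close>
lemma card_reduced_indices:
  assumes "i \<in> {1..k}"
  shows "int (card (R i)) \<le> \<lceil>(real n - real (budget I i)) / 2\<rceil> + 1"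
proof -
  have "2 * card (R i) + budget I i \<le> n + 3"
    using reduction_invariant_final[OF assms] unfolding reduction_invariant_def by simp
  then have "real_of_int (int (card (R i)) - 2) < (real n - real (budget I i)) / 2"
    by (simp add: field_simps)
  then have "int (card (R i)) - 2 < \<lceil>(real n - real (budget I i)) / 2\<rceil>"
    by (simp only: less_ceiling_iff)
  then show ?thesis
    by linarith
qed

lemma Min_reduced_indices: "i \<in> {1..k} \<Longrightarrow> Min (R i) \<in> R i"
  using Min_in[OF finite_reduced_indices] last_index_reduced by blast

section \<open>Robust cost as a minimum of subproblem costs\<close>

lemma ord_props:
  assumes "i \<in> {1..k}"
  shows "distinct (ord i)" "set (ord i) = ground I" "length (ord i) = n"
    "\<And>a b. \<lbrakk>a \<le> b; b < n\<rbrakk> \<Longrightarrow> deviation I (ord i ! b) i \<le> deviation I (ord i ! a) i"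
proof -
  show *: "distinct (ord i)" "set (ord i) = ground I"
    using orders assms by (auto simp: descending_orders_def)
  then show len: "length (ord i) = n"
    using distinct_card by metis
  fix a b assume "a \<le> b" "b < n"
  moreover have "sorted_wrt (\<lambda>a b. deviation I a i \<ge> deviation I b i) (ord i)"
    using orders assms by (auto simp: descending_orders_def)
  ultimately show "deviation I (ord i ! b) i \<le> deviation I (ord i ! a) i"
    using sorted_wrt_nth_less[of _ "ord i" a b] len by (cases "a = b") auto
qed

lemma ground_element_nth: "\<lbrakk>i \<in> {1..k}; e \<in> ground I\<rbrakk> \<Longrightarrow> \<exists>a<n. e = ord i ! a"
  using ord_props(2,3)[of i] by (metis in_set_conv_nth)

lemma deviation_nonneg: "\<lbrakk>i \<in> {1..k}; e \<in> ground I\<rbrakk> \<Longrightarrow> 0 \<le> deviation I e i"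
  using valid by (auto simp: valid_instance_def)

lemma feasible_subset: "q \<in> feasible I \<Longrightarrow> q \<subseteq> ground I"
  and finite_ground: "finite (ground I)"
  using valid by (auto simp: valid_instance_def)

lemma finite_feasible: "finite (feasible I)"
  using valid by (auto simp: valid_instance_def intro: finite_subset)

lemma min_dev_nth:
  assumes "i \<in> {1..k}" "j \<in> {1..n}"
  shows "\<theta> i j = deviation I (ord i ! (j - 1)) i"
proof -
  note o = ord_props[OF assms(1)]
  have take: "set (take j (ord i)) = (\<lambda>a. ord i ! a) ` {0..<j}"
    using assms o(3) by (simp add: nth_image)
  have "Min ((\<lambda>e. deviation I e i) ` set (take j (ord i))) = deviation I (ord i ! (j - 1)) i"
    unfolding take image_image using assms by (intro Min_eqI) (auto intro!: o(4))
  then show ?thesis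
    using assms by (simp add: min_dev_def first_elems_def)
qed

lemma min_dev_last: "\<theta> i (Suc n) = 0"
  by (simp add: min_dev_def)

lemma min_dev_nonneg:
  assumes "i \<in> {1..k}" "j \<in> {1..n + 1}"
  shows "0 \<le> \<theta> i j"
proof (cases "j = n + 1")
  case False
  then show ?thesis
    using assms ord_props[OF assms(1)] by (auto simp: min_dev_nth intro!: deviation_nonneg)
qed (simp add: min_dev_last)

lemma min_dev_antimono:
  assumes "i \<in> {1..k}" "1 \<le> a" "a \<le> b" "b \<le> n + 1"
  shows "\<theta> i b \<le> \<theta> i a"
proof (cases "b = n + 1")
  case True
  then show ?thesis using min_dev_nonneg[of i a] assms by (simp add: min_dev_last)
next
  case False
  then show ?thesis
    using assms ord_props(4)[OF assms(1), of "a - 1" "b - 1"] by (simp add: min_dev_nth)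
qed

text \<open>
  In the descending order, the first \<open>j\<close> elements have deviations at or above the threshold and all
  others at or below it, so restricting the sum to these elements amounts to truncating at zero.
\<close>
lemma excess_over_min_dev:
  assumes i: "i \<in> {1..k}" and j: "j \<in> {1..n + 1}" and q: "q \<subseteq> ground I"
  shows "(\<Sum>e\<in>q \<inter> first_elems ord i j. deviation I e i - \<theta> i j)
    = (\<Sum>e\<in>q. max (deviation I e i - \<theta> i j) 0)"
proof -
  note o = ord_props[OF i]
  have split: "(e \<in> first_elems ord i j \<longrightarrow> \<theta> i j \<le> deviation I e i) \<and>
      (e \<notin> first_elems ord i j \<longrightarrow> deviation I e i \<le> \<theta> i j)" if e: "e \<in> ground I" for e
  proof -
    obtain a where a: "a < n" "e = ord i ! a"
      using ground_element_nth[OF i e] by blast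
    have mem: "e \<in> first_elems ord i j \<longleftrightarrow> a < j"
      using a o(1,3) by (auto simp: first_elems_def in_set_conv_nth nth_eq_iff_index_eq)
    show ?thesis
    proof (cases "j = n + 1")
      case True
      then show ?thesis using mem a deviation_nonneg[OF i e] by (auto simp: min_dev_last)
    next
      case False
      then have "\<theta> i j = deviation I (ord i ! (j - 1)) i" using min_dev_nth i j by auto
      then show ?thesis using mem a False j o(4)[of a "j - 1"] o(4)[of "j - 1" a] by auto
    qed
  qed
  have "(\<Sum>e\<in>q \<inter> first_elems ord i j. deviation I e i - \<theta> i j)
      = (\<Sum>e\<in>q \<inter> first_elems ord i j. max (deviation I e i - \<theta> i j) 0)"
  proof (intro sum.cong refl)
    fix e assume "e \<in> q \<inter> first_elems ord i j"
    then have "\<theta> i j \<le> deviation I e i"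
      using split q by blast
    then show "deviation I e i - \<theta> i j = max (deviation I e i - \<theta> i j) 0"
      by simp
  qed
  also have "\<dots> = (\<Sum>e\<in>q. max (deviation I e i - \<theta> i j) 0)"
    using split q finite_subset[OF q finite_ground] by (intro sum.mono_neutral_left) (auto simp: max_def)
  finally show ?thesis .
qed

lemma gmp_cost_threshold:
  assumes "i \<in> {1..k}" "l i \<in> {1..n + 1}" "q \<subseteq> ground I"
  shows "gmp_cost I ord l q i = (\<Sum>e\<in>q. nominal I e i) + real (budget I i) * \<theta> i (l i)
    + (\<Sum>e\<in>q. max (deviation I e i - \<theta> i (l i)) 0)"
  using excess_over_min_dev[OF assms] by (simp add: gmp_cost_def)

text \<open>
  Weak duality: a scenario raises at most \<open>\<Gamma>\<^sub>i\<close> elements of \<open>q\<close>. Each raise is bounded by the threshold plus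
  the excess over it, and the excess is also summed over the elements that are not raised.
\<close>
lemma scenario_cost_le_gmp_cost:
  assumes i: "i \<in> {1..k}" and l: "l i \<in> {1..n + 1}" and q: "q \<subseteq> ground I"
    and c: "c \<in> uncertainty_set I"
  shows "(\<Sum>e\<in>q. c e i) \<le> gmp_cost I ord l q i"
proof -
  let ?t = "\<theta> i (l i)"
  let ?D = "{e\<in>q. c e i > nominal I e i}"
  have fin: "finite q" using finite_subset[OF q finite_ground] .
  have c': "\<forall>e\<in>ground I. c e i \<le> nominal I e i + deviation I e i"
    "card {e \<in> ground I. c e i > nominal I e i} \<le> budget I i"
    using c i by (auto simp: uncertainty_set_def)
  have "card ?D \<le> card {e \<in> ground I. c e i > nominal I e i}"
    using q finite_ground by (intro card_mono) auto
  then have "real (card ?D) * ?t \<le> real (budget I i) * ?t"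
    using c'(2) min_dev_nonneg[OF i l] by (intro mult_right_mono) auto
  have "(\<Sum>e\<in>q. c e i) \<le> (\<Sum>e\<in>q. nominal I e i + (if c e i > nominal I e i then ?t else 0)
      + max (deviation I e i - ?t) 0)"
  proof (intro sum_mono)
    fix e assume "e \<in> q"
    then have "c e i \<le> nominal I e i + deviation I e i" using c' q by auto
    then show "c e i \<le> nominal I e i + (if c e i > nominal I e i then ?t else 0)
      + max (deviation I e i - ?t) 0" by auto
  qed
  also have "\<dots> = (\<Sum>e\<in>q. nominal I e i) + real (card ?D) * ?t
      + (\<Sum>e\<in>q. max (deviation I e i - ?t) 0)"
    using fin by (simp add: sum.distrib sum.If_cases Int_def)
  also have "\<dots> \<le> gmp_cost I ord l q i"
    unfolding gmp_cost_threshold[of i l q, OF i l q] using \<open>real (card ?D) * ?t \<le> _\<close> by simp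
  finally show ?thesis .
qed

text \<open>
  Equality in weak duality: raise exactly the elements of \<open>D\<close> to their upper bounds, where the
  threshold separates \<open>D\<close> from the rest of \<open>q\<close> and the budget is exhausted or the threshold is free of
  charge.
\<close>
lemma scenario_attaining_gmp_cost:
  assumes i: "i \<in> {1..k}" and l: "l i \<in> {1..n + 1}" and q: "q \<subseteq> ground I"
    and D: "D \<subseteq> q" "card D \<le> budget I i"
    and tight: "card D = budget I i \<or> \<theta> i (l i) = 0"
    and large: "\<And>e. e \<in> D \<Longrightarrow> \<theta> i (l i) \<le> deviation I e i"
    and small: "\<And>e. e \<in> q - D \<Longrightarrow> deviation I e i \<le> \<theta> i (l i)"
  shows "\<exists>c\<in>uncertainty_set I. (\<Sum>e\<in>q. c e i) = gmp_cost I ord l q i"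
proof
  let ?t = "\<theta> i (l i)"
  define c where "c = (\<lambda>e j. nominal I e j + (if j = i \<and> e \<in> D then deviation I e j else 0))"
  have fin: "finite q" using finite_subset[OF q finite_ground] .
  then have finD: "finite D" using D finite_subset by blast
  have "card {e \<in> ground I. c e j > nominal I e j} \<le> budget I j" for j
  proof (cases "j = i")
    case True
    have "card {e \<in> ground I. c e j > nominal I e j} \<le> card D"
      using True finD by (intro card_mono) (auto simp: c_def split: if_splits)
    then show ?thesis using True D by simp
  qed (simp add: c_def)
  then show "c \<in> uncertainty_set I"
    using deviation_nonneg by (auto simp: uncertainty_set_def c_def)
  have "(\<Sum>e\<in>q. max (deviation I e i - ?t) 0) = (\<Sum>e\<in>q. if e \<in> D then deviation I e i - ?t else 0)"
    using large small by (intro sum.cong) (auto simp: max_def not_le intro: order.antisym)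
  also have "\<dots> = (\<Sum>e\<in>D. deviation I e i) - real (card D) * ?t"
    using fin D by (simp add: sum.If_cases Int_absorb1 sum_subtractf Int_def[symmetric])
  finally have "gmp_cost I ord l q i = (\<Sum>e\<in>q. nominal I e i) + (\<Sum>e\<in>D. deviation I e i)"
    using tight unfolding gmp_cost_threshold[of i l q, OF i l q] by auto
  also have "\<dots> = (\<Sum>e\<in>q. c e i)"
    using fin D by (simp add: c_def sum.distrib sum.If_cases Int_absorb1 Int_def[symmetric])
  finally show "(\<Sum>e\<in>q. c e i) = gmp_cost I ord l q i" ..
qed

text \<open>
  The number of elements of \<open>q\<close> among the first \<open>p\<close> elements grows by at most one with \<open>p\<close>, so
  it takes the value \<open>\<Gamma>\<^sub>i\<close> just before exceeding it.
\<close>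
lemma position_after_budget:
  assumes i: "i \<in> {1..k}" and q: "q \<subseteq> ground I" and big: "budget I i < card q"
  shows "\<exists>p. budget I i \<le> p \<and> p < n \<and> card (q \<inter> set (take p (ord i))) = budget I i"
proof -
  note o = ord_props[OF i]
  let ?f = "\<lambda>p. card (q \<inter> set (take p (ord i)))"
  have "?f n > budget I i"
    using o q big by (simp add: Int_absorb2)
  then obtain p where p: "p < n" "?f p \<le> budget I i" "budget I i < ?f (Suc p)"
    using ex_least_nat_less[of "\<lambda>p. budget I i < ?f p" n] by (auto simp: not_less)
  have "?f (Suc p) \<le> card (insert (ord i ! p) (q \<inter> set (take p (ord i))))"
    using p(1) o(3) by (intro card_mono) (auto simp: take_Suc_conv_app_nth)
  also have "\<dots> \<le> Suc (?f p)"
    by (rule card_insert_le_m1) auto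
  finally have "?f p = budget I i"
    using p by simp
  moreover have "?f p \<le> p"
  proof -
    have "?f p \<le> card (set (take p (ord i)))" by (intro card_mono) auto
    also have "\<dots> \<le> length (take p (ord i))" by (rule card_length)
    finally show ?thesis by simp
  qed
  ultimately show ?thesis using p(1) by auto
qed

text \<open>
  If \<open>q\<close> has at most \<open>\<Gamma>\<^sub>i\<close> elements, all of them are raised and the index \<open>n + 1\<close> with threshold zero
  fits. Otherwise the first \<open>\<Gamma>\<^sub>i\<close> elements of \<open>q\<close> in the order are raised, and the deviation at
  an index \<open>p\<close> up to which exactly these occur, or at \<open>p + 1\<close>, fits as threshold. Positions in the list
  start at zero, so index \<open>p + 1\<close> refers to \<open>ord i ! p\<close>.
\<close>
lemma reduced_index_attained:
  assumes i: "i \<in> {1..k}" and q: "q \<subseteq> ground I"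
  shows "\<exists>m\<in>R i. \<forall>l. l i = m \<longrightarrow> (\<exists>c\<in>uncertainty_set I. (\<Sum>e\<in>q. c e i) = gmp_cost I ord l q i)"
proof (cases "card q \<le> budget I i")
  case True
  have "\<exists>c\<in>uncertainty_set I. (\<Sum>e\<in>q. c e i) = gmp_cost I ord l q i" if "l i = n + 1" for l
    using True that q deviation_nonneg[OF i]
    by (intro scenario_attaining_gmp_cost[where D = q] i) (auto simp: min_dev_last)
  then show ?thesis
    using last_index_reduced[OF i] by blast
next
  case False
  note o = ord_props[OF i]
  obtain p where p: "budget I i \<le> p" "p < n" "card (q \<inter> set (take p (ord i))) = budget I i"
    using position_after_budget[OF i q] False by auto
  let ?D = "q \<inter> set (take p (ord i))"
  obtain m where m: "m \<in> R i"
    "\<theta> i m = \<theta> i (p + 1) \<or> budget I i + 1 < p + 1 \<and> \<theta> i m = \<theta> i p"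
    using index_reachable_reduced[OF i, of "p + 1"] p unfolding index_reachable_def by auto
  have "\<theta> i m = deviation I (ord i ! p) i \<or> p > 0 \<and> \<theta> i m = deviation I (ord i ! (p - 1)) i"
    using m(2) p min_dev_nth[OF i, of p] min_dev_nth[OF i, of "p + 1"] by auto
  then have bounds: "(\<forall>a<p. \<theta> i m \<le> deviation I (ord i ! a) i) \<and>
      (\<forall>a\<in>{p..<n}. deviation I (ord i ! a) i \<le> \<theta> i m)"
  proof
    assume \<theta>: "\<theta> i m = deviation I (ord i ! p) i"
    show ?thesis
      unfolding \<theta> using p(2) by (auto intro!: o(4))
  next
    assume \<theta>: "p > 0 \<and> \<theta> i m = deviation I (ord i ! (p - 1)) i"
    show ?thesis
      unfolding conjunct2[OF \<theta>] using p(2) \<theta> by (auto intro!: o(4))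
  qed
  have "\<exists>c\<in>uncertainty_set I. (\<Sum>e\<in>q. c e i) = gmp_cost I ord l q i" if "l i = m" for l
  proof (rule scenario_attaining_gmp_cost[where D = ?D])
    show "l i \<in> {1..n + 1}"
      using m(1) that reduced_indices_subset[OF i] by auto
    show "\<theta> i (l i) \<le> deviation I e i" if "e \<in> ?D" for e
      using that bounds \<open>l i = m\<close> o(3) by (auto simp: in_set_conv_nth)
    show "deviation I e i \<le> \<theta> i (l i)" if e: "e \<in> q - ?D" for e
    proof -
      obtain a where a: "a < n" "e = ord i ! a"
        using ground_element_nth[OF i] e q by blast
      then have "\<not> a < p"
        using e p(2) o(3) by (auto simp: in_set_conv_nth)
      then show ?thesis using a bounds \<open>l i = m\<close> by auto
    qed
  qed (use i q p in auto)
  then show ?thesis using m(1) by blast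
qed

text \<open>
  The attaining scenario bounds the robust cost from below and the subproblem cost bounds it from
  above, so the greatest value over the uncertainty set exists and equals the subproblem cost.
\<close>
lemma robust_cost_le_gmp_cost:
  assumes i: "i \<in> {1..k}" and q: "q \<subseteq> ground I"
  shows "l i \<in> {1..n + 1} \<Longrightarrow> robust_cost I q i \<le> gmp_cost I ord l q i"
    and robust_cost_attained: "\<exists>m\<in>R i. \<forall>l. l i = m \<longrightarrow> robust_cost I q i = gmp_cost I ord l q i"
proof -
  obtain m where m: "m \<in> R i"
    "\<And>l. l i = m \<Longrightarrow> \<exists>c\<in>uncertainty_set I. (\<Sum>e\<in>q. c e i) = gmp_cost I ord l q i"
    using reduced_index_attained[OF i q] by blast
  have eq: "robust_cost I q i = gmp_cost I ord l q i" if "l i = m" for l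
    unfolding robust_cost_def
  proof (rule Greatest_equality)
    show "gmp_cost I ord l q i \<in> (\<lambda>c. \<Sum>e\<in>q. c e i) ` uncertainty_set I"
      using m(2)[of l, OF that] by (metis image_eqI)
    have "l i \<in> {1..n + 1}"
      using m(1) that reduced_indices_subset[OF i] by auto
    then show "v \<le> gmp_cost I ord l q i" if "v \<in> (\<lambda>c. \<Sum>e\<in>q. c e i) ` uncertainty_set I" for v
      using that scenario_cost_le_gmp_cost[of i l q, OF i _ q] by auto
  qed
  then show "\<exists>m\<in>R i. \<forall>l. l i = m \<longrightarrow> robust_cost I q i = gmp_cost I ord l q i"
    using m(1) by blast
  obtain c where "c \<in> uncertainty_set I" "(\<Sum>e\<in>q. c e i) = gmp_cost I ord (\<lambda>_. m) q i"
    using m(2)[of "\<lambda>_. m"] by auto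
  then show "robust_cost I q i \<le> gmp_cost I ord l q i" if "l i \<in> {1..n + 1}"
    using eq[of "\<lambda>_. m"] scenario_cost_le_gmp_cost[of i l q, OF i that q] by metis
qed

abbreviation gmp_covers :: "(nat \<Rightarrow> nat) \<Rightarrow> 'e set set \<Rightarrow> bool" where
  "gmp_covers l \<equiv> covers k (feasible I) (gmp_cost I ord l)"

abbreviation "reduced_vectors \<equiv> \<Pi>\<^sub>E i\<in>{1..k}. R i"

text \<open>
  Given \<open>q\<close>, choose in every objective an index that attains its robust cost, and let \<open>l\<close> be the vector
  of these indices. A member \<open>y\<close> of the cover of \<open>GMP(l)\<close> below \<open>q\<close> has robust cost at most its cost in \<open>GMP(l)\<close>,
  hence at most the cost of \<open>q\<close> there, which is the robust cost of \<open>q\<close>.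
\<close>
lemma union_of_gmp_covers:
  assumes "\<And>l. l \<in> reduced_vectors \<Longrightarrow> gmp_covers l (S l)"
  shows "covers k (feasible I) (robust_cost I) (\<Union>l\<in>reduced_vectors. S l)"
  unfolding covers_def
proof (intro conjI ballI)
  show "(\<Union>l\<in>reduced_vectors. S l) \<subseteq> feasible I"
    using assms by (auto simp: covers_def)
  fix q assume q: "q \<in> feasible I"
  have "\<forall>i\<in>{1..k}. \<exists>m\<in>R i. \<forall>l. l i = m \<longrightarrow> robust_cost I q i = gmp_cost I ord l q i"
    by (intro ballI robust_cost_attained feasible_subset[OF q])
  then obtain w where w: "\<And>i. i \<in> {1..k} \<Longrightarrow> w i \<in> R i"
    "\<And>i l. \<lbrakk>i \<in> {1..k}; l i = w i\<rbrakk> \<Longrightarrow> robust_cost I q i = gmp_cost I ord l q i"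
    by metis
  define l where "l = restrict w {1..k}"
  have l: "l \<in> reduced_vectors"
    using w(1) by (auto simp: l_def)
  then obtain y where y: "y \<in> S l" "\<forall>i\<in>{1..k}. gmp_cost I ord l y i \<le> gmp_cost I ord l q i"
    using assms[OF l] q by (auto simp: covers_def)
  have "robust_cost I y i \<le> robust_cost I q i" if i: "i \<in> {1..k}" for i
  proof -
    have "y \<subseteq> ground I"
      using assms[OF l] y(1) feasible_subset unfolding covers_def by blast
    moreover have "l i \<in> {1..n + 1}"
      using w(1)[OF i] reduced_indices_subset[OF i] i by (auto simp: l_def)
    ultimately have "robust_cost I y i \<le> gmp_cost I ord l y i"
      using robust_cost_le_gmp_cost(1) i by blast
    also have "\<dots> \<le> gmp_cost I ord l q i" using y i by blast
    also have "\<dots> = robust_cost I q i" using w(2)[OF i, of l] i by (simp add: l_def)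
    finally show ?thesis .
  qed
  then show "\<exists>y\<in>\<Union> (S ` reduced_vectors). \<forall>i\<in>{1..k}. robust_cost I y i \<le> robust_cost I q i"
    using y(1) l by blast
qed

lemma solve_covers:
  assumes "l \<in> reduced_vectors"
  shows "gmp_covers l (solve l)"
proof -
  have "l \<in> {1..k} \<rightarrow>\<^sub>E {1..n + 1}"
    using PiE_mono[of "{1..k}" R "\<lambda>_. {1..n + 1}"] assms reduced_indices_subset by blast
  then show ?thesis
    using solver by (auto simp: gmp_solver_def intro: complete_efficient_set_covers)
qed

section \<open>Transferring a cover to the next index\<close>

text \<open>
  Members of \<open>S\<close> contain no element of the first \<open>l h\<close>, so their cost in objective \<open>h\<close> is nominal cost plus
  \<open>\<Gamma>\<^sub>h \<theta>\<close> for both index vectors. For any other solution the excess over the threshold can only grow when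
  the threshold drops, so the comparison made at the larger threshold remains valid.
\<close>
lemma cover_transfer:
  assumes l: "l \<in> reduced_vectors" and h: "h \<in> {1..k}" and m: "m \<in> R h" "m \<le> l h"
    and cov: "gmp_covers (l(h := m)) S"
    and avoid: "\<And>q. q \<in> S \<Longrightarrow> q \<inter> first_elems ord h (l h) = {}"
  shows "gmp_covers l S"
  unfolding covers_def
proof (intro conjI ballI)
  show "S \<subseteq> feasible I"
    using cov by (auto simp: covers_def)
  fix q assume q: "q \<in> feasible I"
  then obtain y where y: "y \<in> S"
    "\<forall>i\<in>{1..k}. gmp_cost I ord (l(h := m)) y i \<le> gmp_cost I ord (l(h := m)) q i"
    using cov by (auto simp: covers_def)
  have lh: "l h \<in> {1..n + 1}" "m \<in> {1..n + 1}"
    using PiE_mem[OF l h] m(1) reduced_indices_subset[OF h] by blast+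
  have "gmp_cost I ord l y h \<le> gmp_cost I ord l q h"
  proof -
    have "y \<inter> first_elems ord h m = {}"
      using avoid[OF y(1)] set_take_subset_set_take[OF m(2), of "ord h"] by (auto simp: first_elems_def)
    then have "(\<Sum>e\<in>y. nominal I e h) + real (budget I h) * \<theta> h m
        = gmp_cost I ord (l(h := m)) y h"
      by (simp add: gmp_cost_def)
    also have "\<dots> \<le> gmp_cost I ord (l(h := m)) q h"
      using y(2) h by blast
    also have "\<dots> = (\<Sum>e\<in>q. nominal I e h) + real (budget I h) * \<theta> h m
        + (\<Sum>e\<in>q. max (deviation I e h - \<theta> h m) 0)"
      using gmp_cost_threshold[of h "l(h := m)" q] h feasible_subset[OF q] lh by simp
    also have "(\<Sum>e\<in>q. max (deviation I e h - \<theta> h m) 0)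
        \<le> (\<Sum>e\<in>q. max (deviation I e h - \<theta> h (l h)) 0)"
      using min_dev_antimono[OF h _ m(2)] lh by (intro sum_mono) auto
    finally have "(\<Sum>e\<in>y. nominal I e h) + real (budget I h) * \<theta> h (l h) \<le> gmp_cost I ord l q h"
      using gmp_cost_threshold[of h l q, OF h lh(1) feasible_subset[OF q]] by simp
    then show ?thesis
      using avoid[OF y(1)] by (simp add: gmp_cost_def)
  qed
  moreover have "gmp_cost I ord l x i = gmp_cost I ord (l(h := m)) x i" if "i \<noteq> h" for x i
    using that by (simp add: gmp_cost_def)
  ultimately have "\<forall>i\<in>{1..k}. gmp_cost I ord l y i \<le> gmp_cost I ord l q i"
    using y(2) by metis
  then show "\<exists>y\<in>S. \<forall>i\<in>{1..k}. gmp_cost I ord l y i \<le> gmp_cost I ord l q i"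
    using y(1) by blast
qed

section \<open>The nested loops\<close>

text \<open>
  The state from which the body can be run for \<open>l\<close>: either nothing has been solved yet, or the
  reference vector of the current level agrees with \<open>l\<close> except that its index in that level comes no later, and a
  cover is stored for it. This is what \<open>cover_transfer\<close> consumes.
\<close>
definition ready :: "(nat \<Rightarrow> nat) \<Rightarrow> 'e dsa_state \<Rightarrow> bool" where
  "ready l s \<longleftrightarrow> l \<in> reduced_vectors \<and> level s \<in> {1..k} \<and>
     (let h = level s in
        ref s h = zero_index k \<or>
        (\<exists>m\<in>R h. m \<le> l h \<and> ref s h = l(h := m) \<and> gmp_covers (ref s h) (opt s (ref s h))))"

text \<open>
  The effect of running loop \<open>j\<close> with all loops nested in it, from \<open>s\<close> to \<open>s'\<close>, where \<open>V\<close> is the set of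
  visited vectors and \<open>v\<close> the first of them. Covers are never destroyed, since every write stores a
  cover. The references below the entry level are untouched. Those from the entry level up to \<open>j - 1\<close> are set by
  the very first body and then stay, because inside the block the level does not fall below \<open>j\<close> again.
\<close>
definition runs_block ::
    "nat \<Rightarrow> (nat \<Rightarrow> nat) set \<Rightarrow> (nat \<Rightarrow> nat) \<Rightarrow> nat \<Rightarrow> 'e dsa_state \<Rightarrow> 'e dsa_state \<Rightarrow> bool" where
  "runs_block j V v c s s' \<longleftrightarrow>
     (\<forall>u. gmp_covers u (opt s u) \<longrightarrow> gmp_covers u (opt s' u)) \<and>
     (\<forall>u\<in>V. gmp_covers u (opt s' u)) \<and>
     (\<forall>i<level s. ref s' i = ref s i) \<and>
     (\<forall>i\<in>{level s..<j}. ref s' i = v) \<and>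
     num_solved s' \<le> num_solved s + c"

definition block :: "nat \<Rightarrow> (nat \<Rightarrow> nat) \<Rightarrow> (nat \<Rightarrow> nat) set" where
  "block j l = {u. (\<forall>i\<in>{j..k}. u i \<in> R i) \<and> (\<forall>i. i \<notin> {j..k} \<longrightarrow> u i = l i)}"

text \<open>
  When a loop is entered anew it starts at the least index, so this is the first vector visited.
\<close>
definition block_start :: "nat \<Rightarrow> (nat \<Rightarrow> nat) \<Rightarrow> nat \<Rightarrow> nat" where
  "block_start j l = (\<lambda>i. if i \<in> {j..k} then Min (R i) else l i)"

lemma dsa_body_runs_block:
  assumes "ready l s"
  shows "runs_block (k + 1) {l} l 1 s (dsa_body I ord solve l s)"
    and level_dsa_body: "level (dsa_body I ord solve l s) = k"
proof -
  let ?h = "level s" and ?s' = "dsa_body I ord solve l s"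
  let ?solves = "ref s ?h = zero_index k \<or> (\<exists>q\<in>opt s (ref s ?h). q \<inter> first_elems ord ?h (l ?h) \<noteq> {})"
  have l: "l \<in> reduced_vectors" and h: "?h \<in> {1..k}"
    using assms by (auto simp: ready_def)
  have opt: "opt ?s' = (opt s)(l := if ?solves then solve l else opt s (ref s ?h))"
    by (auto simp: dsa_body_def Let_def)
  have "gmp_covers l (opt ?s' l)"
  proof (cases ?solves)
    case True
    then show ?thesis using solve_covers[OF l] by (simp add: opt)
  next
    case False
    then obtain m where "m \<in> R ?h" "m \<le> l ?h" "ref s ?h = l(?h := m)"
      "gmp_covers (l(?h := m)) (opt s (ref s ?h))"
      using assms by (auto simp: ready_def Let_def)
    then have "gmp_covers l (opt s (ref s ?h))"
      using cover_transfer[OF l h] False by blast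
    then show ?thesis using False by (simp add: opt)
  qed
  moreover from this have "gmp_covers u (opt ?s' u)" if "gmp_covers u (opt s u)" for u
    using that by (cases "u = l") (simp_all add: opt)
  moreover have "ref ?s' = (\<lambda>i. if i \<in> {?h..k} then l else ref s i)" "num_solved ?s' \<le> num_solved s + 1"
    by (auto simp: dsa_body_def Let_def)
  ultimately show "runs_block (k + 1) {l} l 1 s ?s'"
    by (simp add: runs_block_def)
  show "level ?s' = k"
    by (simp add: dsa_body_def Let_def)
qed

text \<open>
  Successive iterations of loop \<open>j\<close>. After the iteration for \<open>m\<close>, the reference of level \<open>j\<close> is the
  first vector \<open>v(j := m)\<close> of that iteration, and the next iteration starts at \<open>v(j := m')\<close> with the level
  set to \<open>j\<close>: the two vectors differ only in component \<open>j\<close>.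
\<close>
lemma fold_runs_block:
  fixes F :: "nat \<Rightarrow> 'e dsa_state \<Rightarrow> 'e dsa_state"
  assumes j: "j \<in> {1..k}"
    and F: "\<And>m s. \<lbrakk>m \<in> R j; ready (v(j := m)) s; level s \<le> j\<rbrakk>
      \<Longrightarrow> runs_block (j + 1) (V m) (v(j := m)) c s (F m s) \<and> level (F m s) = j"
    and v: "\<And>m. m \<in> R j \<Longrightarrow> v(j := m) \<in> reduced_vectors \<and> v(j := m) \<in> V m"
    and ms: "set (m # ms) \<subseteq> R j" "sorted_wrt (<) (m # ms)"
    and s: "ready (v(j := m)) s" "level s \<le> j"
  shows "runs_block j (\<Union>m\<in>set (m # ms). V m) (v(j := m)) (length (m # ms) * c) s (fold F (m # ms) s)"
  using ms s
proof (induction ms arbitrary: m s)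
  case Nil
  have "runs_block (j + 1) (V m) (v(j := m)) c s (F m s)"
    using F[of m s] Nil by simp
  then show ?case by (simp add: runs_block_def fun_upd_def)
next
  case (Cons m' ms)
  let ?s1 = "F m s" and ?s2 = "fold F (m' # ms) (F m s)"
  have run1: "runs_block (j + 1) (V m) (v(j := m)) c s ?s1" and level1: "level ?s1 = j"
    using F[of m s] Cons.prems by simp_all
  have "ref ?s1 j = v(j := m)" "gmp_covers (v(j := m)) (opt ?s1 (v(j := m)))"
    using run1 Cons.prems v[of m] by (auto simp: runs_block_def)
  then have "ready (v(j := m')) ?s1"
    using j level1 Cons.prems v[of m'] by (auto simp: ready_def Let_def intro!: bexI[of _ m])
  then have run2: "runs_block j (\<Union>m\<in>set (m' # ms). V m) (v(j := m')) (length (m' # ms) * c) ?s1 ?s2"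
    using Cons.IH[of m' ?s1] Cons.prems level1 by (simp add: fun_upd_def)
  have "ref ?s2 i = v(j := m)" if "i \<in> {level s..<j}" for i
    using that run1 run2 level1 by (auto simp: runs_block_def)
  moreover have "ref ?s2 i = ref s i" if "i < level s" for i
    using that run1 run2 level1 Cons.prems by (auto simp: runs_block_def)
  moreover have "num_solved ?s2 \<le> num_solved s + length (m # m' # ms) * c"
    using run1 run2 by (auto simp: runs_block_def)
  ultimately show ?case
    using run1 run2 by (auto simp: runs_block_def)
qed

text \<open>
  Induction from the innermost body outwards. The body leaves the level at \<open>k\<close>, and every outer loop resets it
  to its own number, so an iteration of loop \<open>j\<close> always ends at level \<open>j\<close>; the second conjunct supplies
  this for \<open>j = k\<close>, where no reset takes place. The level may equal \<open>j\<close> on entry because the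
  whole run starts with loop 1 at level 1.
\<close>
lemma dsa_loops_runs_block:
  assumes "j \<le> k + 1" "1 \<le> j"
    and "ready (block_start j l) s" "level s \<le> j"
  shows "runs_block j (block j l) (block_start j l) (\<Prod>i=j..k. card (R i)) s
      (dsa_loops I ord solve [j..<k + 1] l s) \<and>
    (j = k + 1 \<longrightarrow> level (dsa_loops I ord solve [j..<k + 1] l s) = k)"
  using assms
proof (induction j arbitrary: l s rule: inc_induct)
  case base
  have "block_start (Suc k) l = l" "block (Suc k) l = {l}"
    by (auto simp: block_start_def block_def)
  then show ?case
    using dsa_body_runs_block[of l s] level_dsa_body[of l s] base by simp
next
  case (step j)
  have j: "j \<in> {1..k}" using step by auto
  define F where "F = (\<lambda>m s. let s' = dsa_loops I ord solve [Suc j..<k + 1] (l(j := m)) s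
                 in if j < k then s'\<lparr>level := j\<rparr> else s')"
  define ms where "ms = sorted_list_of_set (R j)"
  define v where "v = block_start (Suc j) l"
  have v: "block_start (Suc j) (l(j := m)) = v(j := m)" for m
    by (auto simp: v_def block_start_def)
  have start: "block_start j l = v(j := Min (R j))"
    using j by (auto simp: v_def block_start_def)
  have R: "finite (R j)" "R j \<noteq> {}"
    using finite_reduced_indices[OF j] last_index_reduced[OF j] by auto
  have ms: "set ms = R j" "sorted_wrt (<) ms" "length ms = card (R j)"
    using R by (simp_all add: ms_def)
  obtain ms' where ms': "ms = Min (R j) # ms'"
    using sorted_list_of_set_nonempty[OF R] unfolding ms_def by blast
  have ready: "ready (v(j := Min (R j))) s"
    using step.prems(2) unfolding start by blast
  then have prefix: "v(j := Min (R j)) \<in> reduced_vectors"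
    unfolding ready_def by blast
  have "runs_block j (\<Union>m\<in>set ms. block (Suc j) (l(j := m))) (v(j := Min (R j)))
      (length ms * (\<Prod>i=Suc j..k. card (R i))) s (fold F ms s)"
    unfolding ms'
  proof (rule fold_runs_block[OF j])
    fix m s assume ready_m: "ready (v(j := m)) s" and "level s \<le> j"
    let ?s' = "dsa_loops I ord solve [Suc j..<k + 1] (l(j := m)) s"
    have "level s \<le> Suc j" "1 \<le> Suc j"
      using \<open>level s \<le> j\<close> by simp_all
    then have run: "runs_block (Suc j) (block (Suc j) (l(j := m))) (v(j := m)) (\<Prod>i=Suc j..k. card (R i)) s ?s'"
      and level: "Suc j = k + 1 \<longrightarrow> level ?s' = k"
      using step.IH[of "l(j := m)" s] ready_m unfolding v by blast+
    have "F m s = (if j < k then ?s'\<lparr>level := j\<rparr> else ?s')"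
      unfolding F_def Let_def ..
    moreover have "runs_block (Suc j) W w c s (?s'\<lparr>level := j\<rparr>) = runs_block (Suc j) W w c s ?s'" for W w c
      by (simp add: runs_block_def)
    ultimately show "runs_block (j + 1) (block (Suc j) (l(j := m))) (v(j := m)) (\<Prod>i=Suc j..k. card (R i)) s (F m s)
        \<and> level (F m s) = j"
      using run level j by (cases "j < k") (simp_all del: upt_Suc)
  next
    fix m assume m: "m \<in> R j"
    have "v(j := m) = (v(j := Min (R j)))(j := m)" by simp
    also have "\<dots> \<in> reduced_vectors"
      using prefix m j by (auto simp: PiE_iff extensional_def)
    finally show "v(j := m) \<in> reduced_vectors \<and> v(j := m) \<in> block (Suc j) (l(j := m))"
      using Min_reduced_indices j by (auto simp: v_def block_start_def block_def)
  qed (use ms ms' ready step.prems(3) in auto)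
  moreover have "(\<Union>m\<in>set ms. block (Suc j) (l(j := m))) = block j l"
  proof (intro equalityI subsetI)
    fix u assume "u \<in> (\<Union>m\<in>set ms. block (Suc j) (l(j := m)))"
    then obtain m where m: "m \<in> R j" "\<forall>i\<in>{Suc j..k}. u i \<in> R i"
      "\<forall>i. i \<notin> {Suc j..k} \<longrightarrow> u i = (l(j := m)) i"
      unfolding ms(1) block_def by blast
    have "u j = m"
      using m(3)[rule_format, of j] by simp
    moreover have "{j..k} = insert j {Suc j..k}"
      using j by auto
    ultimately show "u \<in> block j l"
      using m unfolding block_def by simp
  next
    fix u assume "u \<in> block j l"
    then have "u j \<in> set ms" "u \<in> block (Suc j) (l(j := u j))"
      using j ms(1) by (auto simp: block_def)
    then show "u \<in> (\<Union>m\<in>set ms. block (Suc j) (l(j := m)))" by blast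
  qed
  moreover have "length ms * (\<Prod>i=Suc j..k. card (R i)) = (\<Prod>i=j..k. card (R i))"
    using j ms(3) by (simp add: prod.atLeast_Suc_atMost)
  moreover have "dsa_loops I ord solve [j..<k + 1] l s = fold F ms s"
    using j by (simp add: upt_conv_Cons F_def ms_def del: upt_Suc)
  ultimately show ?case
    using start j by (simp add: fun_upd_def)
qed

lemma dsa_run_covers:
  shows "\<And>l. l \<in> reduced_vectors \<Longrightarrow> gmp_covers l (opt (dsa_run I ord solve) l)"
    and num_solved_dsa_run: "num_solved (dsa_run I ord solve) \<le> (\<Prod>i=1..k. card (R i))"
proof -
  let ?l = "\<lambda>_. undefined"
  have "block_start 1 ?l \<in> reduced_vectors"
    using Min_reduced_indices by (auto simp: block_start_def PiE_iff extensional_def)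
  moreover have "k \<ge> 2"
    using valid by (simp add: valid_instance_def)
  ultimately have "ready (block_start 1 ?l) (dsa_init k)"
    by (simp add: ready_def dsa_init_def)
  then have "runs_block 1 (block 1 ?l) (block_start 1 ?l) (\<Prod>i=1..k. card (R i)) (dsa_init k)
      (dsa_run I ord solve)"
    using dsa_loops_runs_block[of 1 ?l "dsa_init k"] by (simp add: dsa_run_def dsa_init_def)
  moreover have "block 1 ?l = reduced_vectors"
    by (auto simp: block_def PiE_iff extensional_def)
  ultimately show "\<And>l. l \<in> reduced_vectors \<Longrightarrow> gmp_covers l (opt (dsa_run I ord solve) l)"
    and "num_solved (dsa_run I ord solve) \<le> (\<Prod>i=1..k. card (R i))"
    by (auto simp: runs_block_def dsa_init_def)
qed

end

section \<open>Correctness and the number of subproblems\<close>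

theorem corollary23:
  fixes I :: "'e robust_instance"
    and ord :: "nat \<Rightarrow> 'e list"
    and solve :: "(nat \<Rightarrow> nat) \<Rightarrow> 'e set set"
  assumes "valid_instance I"
    and "descending_orders I ord"
    and "gmp_solver I ord solve"
  shows "complete_efficient_set (nobj I) (feasible I) (robust_cost I) (dsa_output I ord solve) \<and>
    int (num_solved (dsa_run I ord solve))
      \<le> (\<Prod>i = 1..nobj I. \<lceil>(real (card (ground I)) - real (budget I i)) / 2\<rceil> + 1)"
proof
  interpret dsa_instance I ord solve
    using assms by unfold_locales
  show "complete_efficient_set k (feasible I) (robust_cost I) (dsa_output I ord solve)"
    unfolding dsa_output_def Let_def
    by (intro nondominated_of_cover_complete finite_feasible union_of_gmp_covers dsa_run_covers)
  have "int (num_solved (dsa_run I ord solve)) \<le> (\<Prod>i=1..k. int (card (R i)))"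
    using num_solved_dsa_run by (metis of_nat_le_iff of_nat_prod)
  also have "\<dots> \<le> (\<Prod>i=1..k. \<lceil>(real n - real (budget I i)) / 2\<rceil> + 1)"
    using card_reduced_indices by (intro prod_mono) auto
  finally show "int (num_solved (dsa_run I ord solve))
      \<le> (\<Prod>i=1..k. \<lceil>(real n - real (budget I i)) / 2\<rceil> + 1)" .
qed

end
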